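(* There exist a natural number $c$ and a real constant $\delta>0$ such that the following holds. For every finite set $P$ of points in the Euclidean plane $\mathbb{R}^2$ that is not contained in the union of two lines, $P$ contains a $c$-ordinary triangle; moreover, the number of $c$-ordinary triangles in $P$ is at least $\delta |P|$ (i.e., it is $\Omega(|P|)$).
   Context: For a natural number $c$ and a point set $P$ in the plane, a $c$-ordinary triangle in $P$ is a subset of $P$ consisting of three non-collinear points such that each of the three lines determined by these three points (i.e., the lines through each pair of them) contains at most $c$ points of $P$. *)

theory Defs
  imports "HOL-Analysis.Analysis"
begin

definition is_line :: "(real ^ 2) set \<Rightarrow> bool" where
  "is_line L \<longleftrightarrow> (\<exists>a b. a \<noteq> b \<and> L = affine hull {a, b})"

text \<open>Triangles are unordered, so that counting them counts subsets. The finiteness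
  conjunct is needed because \<^const>\<open>card\<close> is 0 on infinite sets.\<close>

definition ordinary_triangle :: "nat \<Rightarrow> (real ^ 2) set \<Rightarrow> (real ^ 2) set \<Rightarrow> bool" where
  "ordinary_triangle c P T \<longleftrightarrow>
     T \<subseteq> P \<and> card T = 3 \<and> \<not> collinear T \<and>
     (\<forall>a\<in>T. \<forall>b\<in>T. a \<noteq> b \<longrightarrow>
        finite (P \<inter> affine hull {a, b}) \<and> card (P \<inter> affine hull {a, b}) \<le> c)"

end

theory Submission
  imports Defs
begin

text \<open>
  If some line \<open>L\<close> contains a fixed positive fraction of \<open>P\<close>, then \<open>P - L\<close> is not collinear, so by
  Sylvester--Gallai two of its points \<open>a\<close>, \<open>b\<close> span a line with no further point of \<open>P - L\<close>. The lines from
  \<open>a\<close> (or \<open>b\<close>) to the points of \<open>P \<inter> L\<close> are disjoint apart from \<open>a\<close>, so few of them contain more than \<open>c\<close>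
  points, and almost every point of \<open>P \<inter> L\<close> completes \<open>a\<close>, \<open>b\<close> to an ordinary triangle.

  Otherwise the Szemeredi--Trotter bound on the number of \<open>k\<close>-rich lines, summed over all \<open>k > c / 2\<close>, shows
  that only a small fraction of the pairs of points span a line with more than \<open>c\<close> points, so that a
  positive fraction of all triples are ordinary triangles. That bound is derived from the crossing lemma by
  Szekely's argument: consecutive points on rich lines are joined by segments, and two lines cross at
  most once.\<close>

section \<open>Noncrossing segments\<close>

type_synonym seg = "(real ^ 2) \<times> (real ^ 2)"

definition slope :: "seg \<Rightarrow> real" where
  "slope e = (snd e $ 2 - fst e $ 2) / (snd e $ 1 - fst e $ 1)"

definition height :: "seg \<Rightarrow> real \<Rightarrow> real" where
  "height e x = fst e $ 2 + slope e * (x - fst e $ 1)"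

definition spans :: "seg \<Rightarrow> real \<Rightarrow> bool" where
  "spans e x \<longleftrightarrow> fst e $ 1 \<le> x \<and> x \<le> snd e $ 1"

text \<open>Segments sharing an endpoint do not cross, but an endpoint of one in the interior of the other
  counts as a crossing.\<close>

definition crosses :: "seg \<Rightarrow> seg \<Rightarrow> bool" where
  "crosses e f \<longleftrightarrow> (\<exists>x. spans e x \<and> spans f x \<and>
     (fst e $ 1 < x \<and> x < snd e $ 1 \<or> fst f $ 1 < x \<and> x < snd f $ 1) \<and> height e x = height f x)"

lemma vec2_eqI: "p $ 1 = q $ 1 \<Longrightarrow> p $ 2 = q $ 2 \<Longrightarrow> p = (q :: real ^ 2)"
  by (simp add: vec_eq_iff forall_2)

lemma height_fst [simp]: "height e (fst e $ 1) = fst e $ 2"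
  by (simp add: height_def)

lemma height_snd [simp]: "fst e $ 1 < snd e $ 1 \<Longrightarrow> height e (snd e $ 1) = snd e $ 2"
  by (simp add: height_def slope_def)

text \<open>The difference of the heights is affine, so a sign change between \<open>x\<close> and
  \<open>y\<close> forces a zero strictly between them, interior to both segments.\<close>

lemma crosses_if_order_reversed:
  assumes x: "spans e x" "spans f x" and y: "spans e y" "spans f y"
    and less: "height e x < height f x" "height f y < height e y"
  shows "crosses e f"
proof -
  define d where "d t = height e t - height f t" for t
  define l where "l = d y / (d y - d x)"
  define t where "t = l * x + (1 - l) * y"
  have l: "0 < l" "l < 1"
    using less by (auto simp: l_def d_def field_simps)
  have "d t = l * d x + (1 - l) * d y"
    by (simp add: t_def d_def height_def algebra_simps)
  also have "\<dots> = 0"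
    using less by (simp add: l_def d_def field_simps)
  finally have 0: "height e t = height f t" by (simp add: d_def)
  have "x \<noteq> y" using less by auto
  then have "min x y < t \<and> t < max x y"
  proof (cases "x < y")
    case True
    have "l * (y - x) > 0" "(1 - l) * (y - x) > 0" using l True by auto
    then show ?thesis using True by (auto simp: t_def algebra_simps)
  next
    case False
    then have "l * (x - y) > 0" "(1 - l) * (x - y) > 0" using l \<open>x \<noteq> y\<close> by auto
    then show ?thesis using False by (auto simp: t_def algebra_simps)
  qed
  then show ?thesis
    unfolding crosses_def using 0 x y by (intro exI[of _ t]) (auto simp: spans_def)
qed

text \<open>Such segments overlap: halfway to the nearer right endpoint they agree at an interior
  point.\<close>

lemma crosses_if_same_direction:
  assumes "fst e $ 1 < snd e $ 1" "fst f $ 1 < snd f $ 1" "fst e = fst f" "slope e = slope f"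
  shows "crosses e f"
proof -
  define x where "x = (fst e $ 1 + min (snd e $ 1) (snd f $ 1)) / 2"
  have "fst e $ 1 < x" "x < snd e $ 1" "x < snd f $ 1"
    using assms by (auto simp: x_def field_simps min_def)
  then show ?thesis
    unfolding crosses_def using assms by (intro exI[of _ x]) (auto simp: spans_def height_def)
qed

text \<open>The wedge between \<open>e\<close> and the next segment \<open>n\<close> at the same left endpoint, swept to
  the right until it meets its first vertex \<open>z\<close>.\<close>

definition in_wedge :: "seg \<Rightarrow> seg \<Rightarrow> real ^ 2 \<Rightarrow> bool" where
  "in_wedge e n p \<longleftrightarrow> fst e $ 1 < p $ 1 \<and> p $ 1 \<le> snd e $ 1 \<and> p $ 1 \<le> snd n $ 1 \<and>
     height e (p $ 1) \<le> p $ 2 \<and> p $ 2 \<le> height n (p $ 1)"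

definition closes_wedge :: "seg set \<Rightarrow> (real ^ 2) set \<Rightarrow> seg \<Rightarrow> seg \<Rightarrow> real ^ 2 \<Rightarrow> bool" where
  "closes_wedge E V e n z \<longleftrightarrow> n \<in> E \<and> fst n = fst e \<and> slope e < slope n \<and>
     (\<forall>f\<in>E. fst f = fst e \<longrightarrow> slope e < slope f \<longrightarrow> slope n \<le> slope f) \<and>
     z \<in> V \<and> in_wedge e n z \<and> (\<forall>p\<in>V. in_wedge e n p \<longrightarrow> z $ 1 \<le> p $ 1)"

text \<open>At every vertex discard the steepest segment leaving to the right. Each remaining segment opens a
  wedge, and a vertex closes at most two wedges: one whose lower side it lies on and one whose lower
  side passes below it. This bounds the number of segments by three times the number of vertices.\<close>

locale plane_segments =
  fixes E :: "seg set" and V :: "(real ^ 2) set"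
  assumes fin: "finite E" "finite V"
    and left_right: "e \<in> E \<Longrightarrow> fst e $ 1 < snd e $ 1"
    and endpoints: "e \<in> E \<Longrightarrow> fst e \<in> V" "e \<in> E \<Longrightarrow> snd e \<in> V"
    and noncrossing: "e \<in> E \<Longrightarrow> f \<in> E \<Longrightarrow> e \<noteq> f \<Longrightarrow> \<not> crosses e f"
begin

text \<open>Only the weak inequality survives, because noncrossing segments may still meet in a
  common endpoint.\<close>

lemma order_preserved:
  assumes "e \<in> E" "f \<in> E" "spans e x" "spans f x" "spans e y" "spans f y"
    and "height e x < height f x"
  shows "height e y \<le> height f y"
proof (rule ccontr)
  assume "\<not> ?thesis"
  then have "crosses e f"
    using assms by (intro crosses_if_order_reversed[of e x f y]) auto
  moreover have "e \<noteq> f" using assms by auto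
  ultimately show False using noncrossing assms by blast
qed

lemma heights_differ:
  assumes "e \<in> E" "f \<in> E" "e \<noteq> f" "fst e $ 1 < x" "x < snd e $ 1" "spans f x"
  shows "height e x \<noteq> height f x"
  using noncrossing[OF assms(1-3)] assms(4-6) less_imp_le unfolding crosses_def spans_def by blast

text \<open>For \<open>n\<close> take the least slope above that of \<open>e\<close>. The nearer of
  the two right endpoints lies in the wedge, so the wedge has a leftmost vertex.\<close>

lemma closing_vertex_exists:
  assumes "e \<in> E" "f \<in> E" "fst f = fst e" "slope e < slope f"
  shows "\<exists>n z. closes_wedge E V e n z"
proof -
  define H where "H = {f \<in> E. fst f = fst e \<and> slope e < slope f}"
  have "f \<in> H" using assms by (simp add: H_def)
  then have H: "finite H" "H \<noteq> {}" using fin by (simp add: H_def, blast)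
  then obtain n where n: "n \<in> H" "\<And>f. f \<in> H \<Longrightarrow> slope n \<le> slope f"
    using ex_is_arg_min_if_finite[OF H, of slope] by (auto simp: is_arg_min_linorder)
  have nE: "n \<in> E" "fst n = fst e" "slope e < slope n" using n by (auto simp: H_def)
  define W where "W = {p \<in> V. in_wedge e n p}"
  have above: "height e x \<le> height n x" if "fst e $ 1 \<le> x" for x
    using nE that by (auto simp: height_def intro!: mult_right_mono)
  have lr: "fst e $ 1 < snd e $ 1" "fst e $ 1 < snd n $ 1"
    using left_right[of e] left_right[of n] nE assms by auto
  have "height e (snd e $ 1) = snd e $ 2" "height n (snd n $ 1) = snd n $ 2"
    using lr nE by auto
  then have "(if snd e $ 1 \<le> snd n $ 1 then snd e else snd n) \<in> W"
    using nE assms(1) endpoints[of e] endpoints[of n] lr above[of "snd e $ 1"] above[of "snd n $ 1"]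
    by (auto simp: W_def in_wedge_def)
  then have W: "finite W" "W \<noteq> {}" using fin by (auto simp: W_def)
  then obtain z where z: "z \<in> W" "\<And>p. p \<in> W \<Longrightarrow> z $ 1 \<le> p $ 1"
    using ex_is_arg_min_if_finite[OF W, of "\<lambda>p. p $ 1"] by (auto simp: is_arg_min_linorder)
  then show ?thesis
    using n nE z unfolding closes_wedge_def W_def H_def by blast
qed

text \<open>Follow \<open>f\<close> leftwards from \<open>s\<close>: either it starts inside the
  wedge, at a vertex preceding \<open>z\<close>, or it is squeezed into the apex. There it either
  passes through, which is a crossing, or starts with a slope between those of \<open>e\<close> and
  \<open>n\<close>, against the choice of \<open>n\<close>.\<close>

lemma wedge_empty:
  assumes e: "e \<in> E" and cw: "closes_wedge E V e n z" and f: "f \<in> E" "spans f s"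
    and s: "fst e $ 1 < s" "s < z $ 1"
  shows "\<not> (height e s < height f s \<and> height f s < height n s)"
proof
  assume between: "height e s < height f s \<and> height f s < height n s"
  have n: "n \<in> E" "fst n = fst e" and zr: "z $ 1 \<le> snd e $ 1" "z $ 1 \<le> snd n $ 1"
    using cw by (auto simp: closes_wedge_def in_wedge_def)
  have span: "spans e x" "spans n x" if "fst e $ 1 \<le> x" "x \<le> s" for x
    using that n zr s by (auto simp: spans_def)
  have fs: "fst f $ 1 \<le> s" "s \<le> snd f $ 1" using f by (auto simp: spans_def)
  show False
  proof (cases "fst e $ 1 < fst f $ 1")
    case True
    have "spans f (fst f $ 1)" using fs by (auto simp: spans_def)
    with True have "height e (fst f $ 1) \<le> fst f $ 2" "fst f $ 2 \<le> height n (fst f $ 1)"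
      using order_preserved[of e f s "fst f $ 1"] order_preserved[of f n s "fst f $ 1"]
        e f n between span[of s] span[of "fst f $ 1"] fs s by auto
    then have "in_wedge e n (fst f)"
      using True fs s zr by (auto simp: in_wedge_def)
    then show False
      using cw endpoints(1)[OF f(1)] fs s by (auto simp: closes_wedge_def)
  next
    case False
    define a where "a = fst e $ 1"
    have fa: "spans f a" using False fs s by (auto simp: spans_def a_def)
    have ha: "height e a = fst e $ 2" "height n a = fst e $ 2"
      using n height_fst[of n] by (auto simp: a_def)
    have "height f a \<le> fst e $ 2"
      using order_preserved[of n f a s] ha n f between span[of s] span[of a] s fa
      by (force simp: a_def)
    moreover have "fst e $ 2 \<le> height f a"
      using order_preserved[of f e a s] ha e f between span[of s] span[of a] s fa
      by (force simp: a_def)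
    ultimately have hf: "height f a = fst e $ 2" by simp
    have fa1: "fst f $ 1 = a"
    proof (rule ccontr)
      assume "fst f $ 1 \<noteq> a"
      then have "fst f $ 1 < a" "a < snd f $ 1" using False fs s by (auto simp: a_def)
      then have "crosses e f"
        unfolding crosses_def using fa span(1)[of a] s hf ha
        by (intro exI[of _ a]) (auto simp: a_def)
      then show False using noncrossing[OF e f(1)] between by auto
    qed
    with hf have same: "fst f = fst e"
      using height_fst[of f] by (intro vec2_eqI) (auto simp: a_def)
    have pos: "s - fst e $ 1 > 0" using s by simp
    have "slope e < slope f" "slope f < slope n"
      using between pos same n by (auto simp: height_def)
    then show False using cw f same by (force simp: closes_wedge_def)
  qed
qed

text \<open>If \<open>e\<close> ran below \<open>f\<close> at \<open>s\<close>, emptiness of the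
  wedge would put \<open>n\<close> below \<open>f\<close> there, whereas at the abscissa of
  \<open>z\<close> the order is reversed; so \<open>n\<close> and \<open>f\<close> would
  cross.\<close>

lemma closing_vertex_below:
  assumes e: "e \<in> E" "f \<in> E" and cw: "closes_wedge E V e n z" "closes_wedge E V f m z"
    and flag: "height e (z $ 1) = z $ 2 \<longleftrightarrow> height f (z $ 1) = z $ 2"
    and s: "fst e $ 1 < s" "fst f $ 1 < s" "s < z $ 1"
  shows "\<not> height e s < height f s"
proof
  assume less: "height e s < height f s"
  have n: "n \<in> E" "fst n = fst e" "slope e < slope n"
    and ze: "z $ 1 \<le> snd e $ 1" "z $ 1 \<le> snd n $ 1" "z $ 2 \<le> height n (z $ 1)"
    and zf: "z $ 1 \<le> snd f $ 1" "height f (z $ 1) \<le> z $ 2"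
    using cw by (auto simp: closes_wedge_def in_wedge_def)
  have "spans f s" using s zf by (auto simp: spans_def)
  then have le: "height n s \<le> height f s"
    using wedge_empty[OF e(1) cw(1) e(2)] s less by force
  \<comment> \<open>The flag gives strictness: if \<open>f\<close> passes through \<open>z\<close>,
    so does \<open>e\<close>, and \<open>n\<close> is strictly above \<open>e\<close>; otherwise
    \<open>f\<close> is strictly below \<open>z\<close>.\<close>
  have above: "height f (z $ 1) < height n (z $ 1)"
  proof (cases "height f (z $ 1) = z $ 2")
    case True
    have "height e (z $ 1) < height n (z $ 1)"
      using n s by (auto simp: height_def)
    then show ?thesis using True flag by auto
  qed (use ze zf in auto)
  then have nf: "n \<noteq> f" by auto
  then have "height n s \<noteq> height f s"
    using s n ze zf \<open>spans f s\<close> by (intro heights_differ[OF n(1) e(2)]) auto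
  with le above have "crosses n f"
    using s n ze zf by (intro crosses_if_order_reversed[of n s f "z $ 1"]) (auto simp: spans_def)
  then show False using noncrossing[OF n(1) e(2) nf] by simp
qed

lemma card_segments_le: "card E \<le> 3 * card V"
proof -
  \<comment> \<open>The steepest segments. Two with the same left endpoint would overlap, so there
    is at most one per vertex.\<close>
  define T where "T = {e \<in> E. \<forall>f\<in>E. fst f = fst e \<longrightarrow> \<not> slope e < slope f}"
  have "inj_on fst T"
  proof (rule inj_onI)
    fix e f assume ef: "e \<in> T" "f \<in> T" "fst e = fst f"
    then have "slope e = slope f" by (force simp: T_def not_less intro: antisym)
    then have "crosses e f"
      using ef left_right[of e] left_right[of f]
      by (intro crosses_if_same_direction) (auto simp: T_def)
    then show "e = f" using noncrossing ef unfolding T_def by blast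
  qed
  then have cardT: "card T \<le> card V"
    using endpoints fin by (intro card_inj_on_le[of fst]) (auto simp: T_def)
  have "\<forall>e\<in>E - T. \<exists>n z. closes_wedge E V e n z"
    using closing_vertex_exists by (auto simp: T_def)
  then obtain n z where cw: "\<And>e. e \<in> E - T \<Longrightarrow> closes_wedge E V e (n e) (z e)"
    by metis
  \<comment> \<open>The Boolean tells whether the lower side passes through the closing vertex or
    below it; injectivity of \<open>h\<close> then allows two wedges per vertex.\<close>
  define h where "h e = (z e, height e (z e $ 1) = z e $ 2)" for e
  have "inj_on h (E - T)"
  proof (rule inj_onI, rule ccontr)
    fix e f assume ef: "e \<in> E - T" "f \<in> E - T" "h e = h f" "e \<noteq> f"
    \<comment> \<open>An abscissa right of both apexes and left of the common closing vertex, where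
      the two lower sides have different heights.\<close>
    define s where "s = (max (fst e $ 1) (fst f $ 1) + z e $ 1) / 2"
    have cwe: "closes_wedge E V e (n e) (z e)" "closes_wedge E V f (n f) (z e)"
      and z: "z f = z e" and flag: "height e (z e $ 1) = z e $ 2 \<longleftrightarrow> height f (z e $ 1) = z e $ 2"
      using cw[of e] cw[of f] ef by (auto simp: h_def)
    have "fst e $ 1 < z e $ 1" "fst f $ 1 < z e $ 1" "z e $ 1 \<le> snd e $ 1" "z e $ 1 \<le> snd f $ 1"
      using cwe by (auto simp: closes_wedge_def in_wedge_def)
    then have s: "fst e $ 1 < s" "fst f $ 1 < s" "s < z e $ 1" "s < snd e $ 1" "s < snd f $ 1"
      by (auto simp: s_def max_def field_simps)
    have "height e s \<noteq> height f s"
      using ef s by (intro heights_differ) (auto simp: spans_def)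
    moreover have "\<not> height e s < height f s" "\<not> height f s < height e s"
      using closing_vertex_below[of e f "n e" "z e" "n f" s]
        closing_vertex_below[of f e "n f" "z e" "n e" s] cwe ef flag s by auto
    ultimately show False by auto
  qed
  moreover have "h ` (E - T) \<subseteq> V \<times> UNIV"
    using cw by (force simp: h_def closes_wedge_def)
  ultimately have "card (E - T) \<le> card (V \<times> (UNIV :: bool set))"
    using fin by (intro card_inj_on_le) auto
  moreover have "card E = card T + card (E - T)"
    using fin by (subst card_Un_disjoint[symmetric]) (auto simp: T_def intro: arg_cong[where f=card])
  ultimately show ?thesis using cardT by (simp add: card_cartesian_product)
qed

end

section \<open>The crossing lemma\<close>

text \<open>Colours of different points are independent, each being 0 with probability
  \<open>1 / q\<close>; the identity is cleared of denominators to stay in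
  \<open>nat\<close>.\<close>

lemma card_colourings:
  assumes "finite P" "A \<subseteq> P" "0 < q"
  shows "card {g \<in> P \<rightarrow>\<^sub>E {..<q}. \<forall>a\<in>A. g a = 0} * q ^ card A = q ^ card (P :: 'a set)"
proof -
  have "{g \<in> P \<rightarrow>\<^sub>E {..<q}. \<forall>a\<in>A. g a = 0} = (\<Pi>\<^sub>E x\<in>P. if x \<in> A then {0} else {..<q})"
  proof (rule set_eqI)
    fix g
    have "(\<forall>x\<in>P. g x \<in> (if x \<in> A then {0} else {..<q})) \<longleftrightarrow> (\<forall>x\<in>P. g x < q) \<and> (\<forall>x\<in>A. g x = 0)"
    proof
      assume *: "\<forall>x\<in>P. g x \<in> (if x \<in> A then {0} else {..<q})"
      have "g x < q" if "x \<in> P" for x using bspec[OF * that] assms(3) by (cases "x \<in> A") auto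
      moreover have "g x = 0" if "x \<in> A" for x using bspec[OF *, of x] that assms(2) by auto
      ultimately show "(\<forall>x\<in>P. g x < q) \<and> (\<forall>x\<in>A. g x = 0)" by blast
    qed simp
    then show "g \<in> {g \<in> P \<rightarrow>\<^sub>E {..<q}. \<forall>a\<in>A. g a = 0} \<longleftrightarrow>
        g \<in> (\<Pi>\<^sub>E x\<in>P. if x \<in> A then {0} else {..<q})"
      unfolding PiE_iff mem_Collect_eq lessThan_iff by blast
  qed
  also have "card \<dots> = (\<Prod>x\<in>P. if x \<in> A then 1 else q)"
    using assms by (subst card_PiE) (auto intro: prod.cong)
  also have "\<dots> = q ^ card (P - A)"
    using assms by (subst prod.subset_diff[of A P]) auto
  finally show ?thesis
    using assms by (simp add: power_add[symmetric] card_Diff_subset finite_subset card_mono)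
qed

text \<open>Average over all colourings of the vertices with \<open>q\<close> colours: the bound for noncrossing
  segments applies to the vertices of colour 0 after deleting one segment from each crossing.\<close>

lemma crossing_lemma:
  fixes P :: "(real ^ 2) set"
  assumes fin: "finite E" "finite P"
    and left_right: "\<And>e. e \<in> E \<Longrightarrow> fst e $ 1 < snd e $ 1"
    and endpoints: "\<And>e. e \<in> E \<Longrightarrow> fst e \<in> P" "\<And>e. e \<in> E \<Longrightarrow> snd e \<in> P"
    and four: "\<And>e f. (e, f) \<in> C \<Longrightarrow> card {fst e, snd e, fst f, snd f} = 4"
    and q: "0 < q"
    and C: "C = {(e, f). e \<in> E \<and> f \<in> E \<and> e \<noteq> f \<and> crosses e f}"
  shows "card E * q ^ 2 \<le> 3 * card P * q ^ 3 + card C"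
proof -
  \<comment> \<open>\<open>V g\<close>, \<open>S g\<close> and \<open>X g\<close> are the vertices,
    segments and crossing pairs with all endpoints of colour 0; on average they are the fractions
    \<open>1 / q\<close>, \<open>1 / q ^ 2\<close> and \<open>1 / q ^ 4\<close> of the
    whole.\<close>
  define G where "G = P \<rightarrow>\<^sub>E {..<q}"
  define N where "N = q ^ card P"
  define V where "V g = {p \<in> P. g p = (0::nat)}" for g
  define S where "S g = {e \<in> E. \<forall>a\<in>{fst e, snd e}. g a = (0::nat)}" for g
  define X where "X g = {ef \<in> C. \<forall>a\<in>{fst (fst ef), snd (fst ef), fst (snd ef), snd (snd ef)}. g a = (0::nat)}" for g
  have finC: "finite C" using fin by (auto simp: C intro: finite_subset[of _ "E \<times> E"])
  have finG: "finite G" using fin by (auto simp: G_def intro: finite_PiE)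
  have le: "card (S g) \<le> 3 * card (V g) + card (X g)" for g
  proof -
    have "plane_segments (S g - fst ` X g) (V g)"
    proof
      fix e f assume ef: "e \<in> S g - fst ` X g" "f \<in> S g - fst ` X g" "e \<noteq> f"
      show "\<not> crosses e f"
      proof
        assume "crosses e f"
        then have "(e, f) \<in> X g" using ef by (simp add: X_def S_def C)
        then show False using ef by force
      qed
    qed (use fin left_right endpoints in \<open>auto simp: S_def V_def simp del: split_paired_All\<close>)
    then have "card (S g - fst ` X g) \<le> 3 * card (V g)"
      by (rule plane_segments.card_segments_le)
    moreover have "card (S g) \<le> card (S g - fst ` X g) + card (fst ` X g)"
      using diff_card_le_card_Diff[of "fst ` X g" "S g"] finC by (simp add: X_def)
    moreover have "card (fst ` X g) \<le> card (X g)"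
      using finC by (intro card_image_le) (simp add: X_def)
    ultimately show ?thesis by linarith
  qed
  have count: "card {g \<in> G. \<forall>a\<in>A. g a = 0} * q ^ card A = N" if "A \<subseteq> P" for A
    using card_colourings[OF fin(2) that q] by (simp add: G_def N_def)
  have "(\<Sum>g\<in>G. card (S g)) * q ^ 2 = (\<Sum>e\<in>E. card {g \<in> G. \<forall>a\<in>{fst e, snd e}. g a = 0}) * q ^ 2"
    unfolding S_def using fin finG by (subst sum_multicount_gen) auto
  also have "\<dots> = (\<Sum>e\<in>E. N)"
    unfolding sum_distrib_right
  proof (rule sum.cong)
    fix e assume "e \<in> E"
    then show "card {g \<in> G. \<forall>a\<in>{fst e, snd e}. g a = 0} * q ^ 2 = N"
      using count[of "{fst e, snd e}"] endpoints[of e] left_right[of e]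
      by (cases "fst e = snd e") (auto simp: power2_eq_square)
  qed simp
  finally have S: "(\<Sum>g\<in>G. card (S g)) * q ^ 2 = card E * N" by simp
  have "(\<Sum>g\<in>G. card (V g)) * q = (\<Sum>p\<in>P. card {g \<in> G. g p = 0}) * q"
    unfolding V_def using fin finG by (subst sum_multicount_gen) auto
  also have "\<dots> = (\<Sum>p\<in>P. N)"
    unfolding sum_distrib_right
  proof (rule sum.cong)
    fix p assume "p \<in> P"
    then show "card {g \<in> G. g p = 0} * q = N" using count[of "{p}"] by simp
  qed simp
  finally have V: "(\<Sum>g\<in>G. card (V g)) * q = card P * N" by simp
  \<comment> \<open>The exponent 4 comes from the four distinct endpoints of a crossing
    pair.\<close>
  have "(\<Sum>g\<in>G. card (X g)) * q ^ 4 = (\<Sum>ef\<in>C. card {g \<in> G.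
      \<forall>a\<in>{fst (fst ef), snd (fst ef), fst (snd ef), snd (snd ef)}. g a = 0}) * q ^ 4"
    unfolding X_def using finC finG by (subst sum_multicount_gen) auto
  also have "\<dots> = (\<Sum>ef\<in>C. N)"
    unfolding sum_distrib_right
  proof (rule sum.cong)
    fix ef assume ef: "ef \<in> C"
    obtain e f where [simp]: "ef = (e, f)" by (cases ef)
    have "{fst e, snd e, fst f, snd f} \<subseteq> P" using ef endpoints by (simp add: C)
    then show "card {g \<in> G. \<forall>a\<in>{fst (fst ef), snd (fst ef), fst (snd ef), snd (snd ef)}. g a = 0}
        * q ^ 4 = N"
      using count[of "{fst e, snd e, fst f, snd f}"] four[of e f] ef by simp
  qed simp
  finally have X: "(\<Sum>g\<in>G. card (X g)) * q ^ 4 = card C * N" by simp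
  have "card E * q ^ 2 * N = (\<Sum>g\<in>G. card (S g)) * q ^ 2 * q ^ 2"
    using S by simp
  also have "\<dots> \<le> (\<Sum>g\<in>G. 3 * card (V g) + card (X g)) * q ^ 2 * q ^ 2"
    using le by (intro mult_right_mono sum_mono) auto
  also have "\<dots> = 3 * ((\<Sum>g\<in>G. card (V g)) * q) * q ^ 3 + (\<Sum>g\<in>G. card (X g)) * q ^ 4"
    by (simp add: sum.distrib sum_distrib_left[symmetric] algebra_simps eval_nat_numeral)
  also have "\<dots> = (3 * card P * q ^ 3 + card C) * N"
    unfolding V X by (simp add: algebra_simps)
  finally show ?thesis using q by (simp add: N_def)
qed

section \<open>Rich lines\<close>

definition nonvertical :: "(real ^ 2) set \<Rightarrow> bool" where
  "nonvertical L \<longleftrightarrow> inj_on (\<lambda>p. p $ 1) L"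

text \<open>Twice the signed area of the triangle \<open>p\<close>, \<open>q\<close>,
  \<open>r\<close>; it makes membership in a line a polynomial equation.\<close>

definition cross :: "real ^ 2 \<Rightarrow> real ^ 2 \<Rightarrow> real ^ 2 \<Rightarrow> real" where
  "cross p q r = (q $ 1 - p $ 1) * (r $ 2 - p $ 2) - (q $ 2 - p $ 2) * (r $ 1 - p $ 1)"

lemma mem_line_iff_param:
  "r \<in> affine hull {p, q} \<longleftrightarrow> (\<exists>t. r = p + t *\<^sub>R (q - p))"
proof -
  have "r \<in> affine hull {p, q} \<longleftrightarrow> (\<exists>u v. u + v = 1 \<and> r = u *\<^sub>R p + v *\<^sub>R q)"
    by (auto simp: affine_hull_2)
  also have "\<dots> \<longleftrightarrow> (\<exists>v. r = (1 - v) *\<^sub>R p + v *\<^sub>R q)"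
    by (metis add_diff_cancel_right' diff_add_cancel)
  finally show ?thesis by (simp add: algebra_simps)
qed

lemma mem_line_iff_cross:
  assumes "p \<noteq> q"
  shows "r \<in> affine hull {p, q} \<longleftrightarrow> cross p q r = 0"
proof
  assume "r \<in> affine hull {p, q}"
  then show "cross p q r = 0" by (auto simp: mem_line_iff_param cross_def)
next
  assume 0: "cross p q r = 0"
  show "r \<in> affine hull {p, q}"
  proof (cases "q $ 1 = p $ 1")
    case False
    define t where "t = (r $ 1 - p $ 1) / (q $ 1 - p $ 1)"
    have "r $ 1 = p $ 1 + t * (q $ 1 - p $ 1)" using False by (simp add: t_def)
    moreover have "r $ 2 = p $ 2 + t * (q $ 2 - p $ 2)"
      using False 0 by (simp add: t_def cross_def divide_simps) (simp add: algebra_simps)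
    ultimately show ?thesis
      unfolding mem_line_iff_param by (intro exI[of _ t] vec2_eqI) auto
  next
    case True
    define t where "t = (r $ 2 - p $ 2) / (q $ 2 - p $ 2)"
    have "q $ 2 \<noteq> p $ 2" using assms True vec2_eqI by metis
    then have "r $ 2 = p $ 2 + t * (q $ 2 - p $ 2)" by (simp add: t_def)
    moreover have "r $ 1 = p $ 1 + t * (q $ 1 - p $ 1)"
      using True 0 \<open>q $ 2 \<noteq> p $ 2\<close> by (simp add: cross_def)
    ultimately show ?thesis
      unfolding mem_line_iff_param by (intro exI[of _ t] vec2_eqI) auto
  qed
qed

lemma line_eq_hull:
  assumes "is_line L" "p \<in> L" "q \<in> L" "p \<noteq> q"
  shows "L = affine hull {p, q}"
proof -
  obtain a b where ab: "a \<noteq> b" "L = affine hull {a, b}" using assms by (auto simp: is_line_def)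
  obtain s t where s: "p = a + s *\<^sub>R (b - a)" and t: "q = a + t *\<^sub>R (b - a)"
    using assms ab mem_line_iff_param by metis
  have st: "t - s \<noteq> 0" using assms s t by auto
  \<comment> \<open>Sliding the base points along the line only rescales the area by the nonzero
    factor \<open>t - s\<close>.\<close>
  have cross: "cross p q r = (t - s) * cross a b r" for r
    by (simp add: cross_def s t algebra_simps)
  show ?thesis
    unfolding ab using st ab(1) assms(4) by (auto simp: mem_line_iff_cross cross)
qed

lemma lines_eq:
  assumes "is_line L" "is_line L'" "p \<in> L" "q \<in> L" "p \<in> L'" "q \<in> L'" "p \<noteq> q"
  shows "L = L'"
  using line_eq_hull assms by metis

lemma is_line_hull: "p \<noteq> q \<Longrightarrow> is_line (affine hull {p, q})"
  by (auto simp: is_line_def)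

lemma mem_line_iff_height:
  assumes "is_line L" "fst e \<in> L" "snd e \<in> L" "fst e $ 1 < snd e $ 1"
  shows "r \<in> L \<longleftrightarrow> r $ 2 = height e (r $ 1)"
proof -
  have "L = affine hull {fst e, snd e}" using assms by (intro line_eq_hull) auto
  moreover have "fst e \<noteq> snd e" using assms by auto
  ultimately show ?thesis
    using assms(4) by (auto simp: mem_line_iff_cross cross_def height_def slope_def field_simps)
qed

section \<open>Segments between consecutive points\<close>

definition consec :: "(real ^ 2) set \<Rightarrow> (real ^ 2) set \<Rightarrow> seg set" where
  "consec P L = {e. fst e \<in> P \<inter> L \<and> snd e \<in> P \<inter> L \<and> fst e $ 1 < snd e $ 1 \<and>
     (\<forall>w\<in>P \<inter> L. \<not> (fst e $ 1 < w $ 1 \<and> w $ 1 < snd e $ 1))}"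

lemma finite_consec: "finite P \<Longrightarrow> finite (consec P L)"
  by (rule finite_subset[of _ "P \<times> P"]) (auto simp: consec_def mem_Times_iff)

text \<open>Each point of \<open>P \<inter> L\<close> except the rightmost starts a segment to its
  right neighbour.\<close>

lemma card_consec:
  assumes "finite P" "nonvertical L"
  shows "card (P \<inter> L) \<le> Suc (card (consec P L))"
proof -
  define A where "A = P \<inter> L"
  define B where "B = {u \<in> A. \<exists>v\<in>A. u $ 1 < v $ 1}"
  have finA: "finite A" using assms by (simp add: A_def)
  have inj: "u = v" if "u \<in> A" "v \<in> A" "u $ 1 = v $ 1" for u v
    using assms that by (auto simp: nonvertical_def A_def inj_on_def)
  have "B \<subseteq> fst ` consec P L"
  proof
    fix u assume u: "u \<in> B"
    define W where "W = {v \<in> A. u $ 1 < v $ 1}"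
    have W: "finite W" "W \<noteq> {}" using u finA by (auto simp: W_def B_def)
    then obtain v where v: "v \<in> W" "\<And>w. w \<in> W \<Longrightarrow> v $ 1 \<le> w $ 1"
      using ex_is_arg_min_if_finite[OF W, of "\<lambda>p. p $ 1"] by (auto simp: is_arg_min_linorder)
    then have "(u, v) \<in> consec P L"
      using u by (force simp: consec_def W_def B_def A_def)
    then show "u \<in> fst ` consec P L" by force
  qed
  then have "card B \<le> card (consec P L)"
    using finite_consec[OF assms(1)] by (meson card_image_le card_mono finite_imageI order_trans)
  moreover have "u = v" if "u \<in> A - B" "v \<in> A - B" for u v
  proof (rule inj)
    show "u $ 1 = v $ 1" using that by (intro antisym) (auto simp: B_def not_less)
  qed (use that in auto)
  then have "card (A - B) \<le> Suc 0"
    using finA by (subst card_le_Suc0_iff_eq) auto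
  moreover have "card A = card B + card (A - B)"
    using finA by (subst card_Un_disjoint[symmetric]) (auto simp: B_def intro: arg_cong[where f=card])
  ultimately show ?thesis by (simp add: A_def)
qed

text \<open>No endpoint of \<open>f\<close> lies strictly inside \<open>e\<close>, so
  \<open>f\<close> covers \<open>e\<close>; but neither does an endpoint of \<open>e\<close> lie
  strictly inside \<open>f\<close>.\<close>

lemma consec_unique:
  assumes "nonvertical L" "e \<in> consec P L" "f \<in> consec P L"
    and "fst e $ 1 < x" "x < snd e $ 1" "spans f x"
  shows "e = f"
proof -
  have "fst f $ 1 \<le> fst e $ 1" "snd e $ 1 \<le> snd f $ 1"
    using assms by (force simp: consec_def spans_def)+
  moreover from this have "\<not> fst f $ 1 < fst e $ 1" "\<not> snd e $ 1 < snd f $ 1"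
    using assms by (force simp: consec_def spans_def)+
  ultimately have "fst f $ 1 = fst e $ 1" "snd f $ 1 = snd e $ 1" by auto
  then have "fst f = fst e" "snd f = snd e"
    using assms by (auto simp: consec_def nonvertical_def inj_on_def)
  then show ?thesis by (simp add: prod_eq_iff)
qed

text \<open>A common point interior to one of the segments is not in \<open>P\<close>, hence not an
  endpoint of the other. Two segments on one line are excluded by
  \<open>consec_unique\<close>.\<close>

lemma crosses_consec:
  assumes L: "is_line L" "nonvertical L" and L': "is_line L'" "nonvertical L'"
    and e: "e \<in> consec P L" and f: "f \<in> consec P L'" and "e \<noteq> f" "crosses e f"
  shows "L \<noteq> L' \<and> (\<exists>z \<in> L \<inter> L'. fst e $ 1 < z $ 1 \<and> z $ 1 < snd e $ 1 \<and>
    fst f $ 1 < z $ 1 \<and> z $ 1 < snd f $ 1)"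
proof -
  obtain x where x: "spans e x" "spans f x" "height e x = height f x"
    and inner: "fst e $ 1 < x \<and> x < snd e $ 1 \<or> fst f $ 1 < x \<and> x < snd f $ 1"
    using assms by (auto simp: crosses_def)
  define z :: "real ^ 2" where "z = vector [x, height e x]"
  have z1: "z $ 1 = x" "z $ 2 = height e x" by (auto simp: z_def vector_2)
  have e': "fst e \<in> P \<inter> L" "snd e \<in> P \<inter> L" "fst e $ 1 < snd e $ 1"
    and f': "fst f \<in> P \<inter> L'" "snd f \<in> P \<inter> L'" "fst f $ 1 < snd f $ 1"
    using e f by (auto simp: consec_def)
  have zL: "z \<in> L"
    using mem_line_iff_height[of L e z] L e' z1 by auto
  have zL': "z \<in> L'"
    using mem_line_iff_height[of L' f z] L' f' z1 x by auto
  have ne: "L \<noteq> L'"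
    using consec_unique[of L e P f x] consec_unique[of L f P e x] assms x inner by auto
  have inj: "p = q" if "p \<in> L \<and> q \<in> L \<or> p \<in> L' \<and> q \<in> L'" "p $ 1 = q $ 1" for p q
    using L L' that by (auto simp: nonvertical_def inj_on_def)
  have notP: "z \<notin> P"
    using inner e f zL zL' z1 by (auto simp: consec_def)
  have "fst e $ 1 \<noteq> x" "snd e $ 1 \<noteq> x" "fst f $ 1 \<noteq> x" "snd f $ 1 \<noteq> x"
    using inj[of "fst e" z] inj[of "snd e" z] inj[of "fst f" z] inj[of "snd f" z]
      zL zL' notP e' f' z1 by auto
  then show ?thesis
    using ne zL zL' z1 x by (intro conjI bexI[of _ z]) (auto simp: spans_def)
qed

text \<open>Szekely's drawing: every line contributes at least \<open>j\<close> consecutive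
  segments, and crossings inject into pairs of lines because two lines meet at most once.\<close>

lemma incidence_bound:
  assumes P: "finite P" and Lam: "finite \<Lambda>" "\<And>L. L \<in> \<Lambda> \<Longrightarrow> is_line L \<and> nonvertical L"
    and rich: "\<And>L. L \<in> \<Lambda> \<Longrightarrow> Suc j \<le> card (P \<inter> L)" and q: "0 < q"
  shows "card \<Lambda> * j * q ^ 2 \<le> 3 * card P * q ^ 3 + card \<Lambda> ^ 2"
proof -
  define E where "E = (\<Union>L\<in>\<Lambda>. consec P L)"
  define C where "C = {(e, f). e \<in> E \<and> f \<in> E \<and> e \<noteq> f \<and> crosses e f}"
  have disj: "consec P L \<inter> consec P L' = {}" if "L \<in> \<Lambda>" "L' \<in> \<Lambda>" "L \<noteq> L'" for L L'
    using Lam that lines_eq[of L L'] by (fastforce simp: consec_def)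
  have "card \<Lambda> * j = (\<Sum>L\<in>\<Lambda>. j)" by simp
  also have "\<dots> \<le> (\<Sum>L\<in>\<Lambda>. card (consec P L))"
  proof (rule sum_mono)
    fix L assume "L \<in> \<Lambda>"
    then show "j \<le> card (consec P L)" using card_consec[OF P, of L] rich[of L] Lam by fastforce
  qed
  also have "\<dots> = card E"
    unfolding E_def using P Lam disj finite_consec by (intro card_UN_disjoint[symmetric]) auto
  finally have E: "card \<Lambda> * j \<le> card E" .
  define R where "R e f L L' \<longleftrightarrow> e \<in> consec P L \<and> f \<in> consec P L' \<and> L \<in> \<Lambda> \<and> L' \<in> \<Lambda> \<and> L \<noteq> L' \<and>
    (\<exists>z \<in> L \<inter> L'. fst e $ 1 < z $ 1 \<and> z $ 1 < snd e $ 1 \<and>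
      fst f $ 1 < z $ 1 \<and> z $ 1 < snd f $ 1)" for e f L L'
  have "\<exists>L L'. R e f L L'" if "(e, f) \<in> C" for e f
    using that crosses_consec[of _ _ e P f] Lam unfolding R_def C_def E_def
    by clarsimp meson
  then obtain l1 l2 where R: "\<And>e f. (e, f) \<in> C \<Longrightarrow> R e f (l1 e f) (l2 e f)" by metis
  have finE: "finite E" using P Lam finite_consec by (simp add: E_def)
  have finC: "finite C" by (rule finite_subset[of C "E \<times> E"]) (auto simp: C_def finE)
  \<comment> \<open>The pair of lines determines the crossing point, and that point determines the
    segment on each line.\<close>
  have "inj_on (\<lambda>(e, f). (l1 e f, l2 e f)) C"
  proof (rule inj_onI)
    fix x y assume xy: "x \<in> C" "y \<in> C" "(\<lambda>(e, f). (l1 e f, l2 e f)) x = (\<lambda>(e, f). (l1 e f, l2 e f)) y"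
    obtain e f e' f' where split: "x = (e, f)" "y = (e', f')" by (cases x, cases y)
    have ef: "(e, f) \<in> C" "(e', f') \<in> C" and eq: "l1 e f = l1 e' f'" "l2 e f = l2 e' f'"
      using xy by (auto simp: split)
    define L where "L = l1 e' f'"
    define L' where "L' = l2 e' f'"
    have R1: "R e f L L'" and R2: "R e' f' L L'"
      using R[OF ef(1)] R[OF ef(2)] eq by (auto simp: L_def L'_def)
    obtain z z' where z: "z \<in> L \<inter> L'" "fst e $ 1 < z $ 1" "z $ 1 < snd e $ 1"
        "fst f $ 1 < z $ 1" "z $ 1 < snd f $ 1"
      and z': "z' \<in> L \<inter> L'" "fst e' $ 1 < z' $ 1" "z' $ 1 < snd e' $ 1"
        "fst f' $ 1 < z' $ 1" "z' $ 1 < snd f' $ 1"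
      using R1 R2 unfolding R_def by blast
    have LL: "L \<in> \<Lambda>" "L' \<in> \<Lambda>" "L \<noteq> L'" using R1 by (auto simp: R_def)
    then have "z = z'" using lines_eq[of L L' z z'] z z' Lam by auto
    then have spans: "spans e' (z $ 1)" "spans f' (z $ 1)" using z' by (simp_all add: spans_def)
    have mem: "e \<in> consec P L" "e' \<in> consec P L" "f \<in> consec P L'" "f' \<in> consec P L'"
      using R1 R2 unfolding R_def by blast+
    have "e = e'"
      using Lam LL by (intro consec_unique[OF _ mem(1,2) z(2,3) spans(1)]) blast
    moreover have "f = f'"
      using Lam LL by (intro consec_unique[OF _ mem(3,4) z(4,5) spans(2)]) blast
    ultimately show "x = y" by (simp add: split)
  qed
  moreover have "(\<lambda>(e, f). (l1 e f, l2 e f)) ` C \<subseteq> \<Lambda> \<times> \<Lambda>"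
    using R by (force simp: R_def)
  ultimately have "card C \<le> card (\<Lambda> \<times> \<Lambda>)"
    using Lam by (intro card_inj_on_le) auto
  then have C: "card C \<le> card \<Lambda> ^ 2" by (simp add: card_cartesian_product power2_eq_square)
  have E_props: "fst e \<in> P" "snd e \<in> P" "fst e $ 1 < snd e $ 1" if "e \<in> E" for e
    using that unfolding E_def consec_def by blast+
  have "card E * q ^ 2 \<le> 3 * card P * q ^ 3 + card C"
  proof (rule crossing_lemma[OF _ P _ _ _ _ q C_def])
    fix e f assume ef: "(e, f) \<in> C"
    define L where "L = l1 e f"
    define L' where "L' = l2 e f"
    have R1: "R e f L L'" using R[OF ef] by (simp add: L_def L'_def)
    have L: "L \<in> \<Lambda>" "L' \<in> \<Lambda>" "L \<noteq> L'" and e: "e \<in> consec P L" and f: "f \<in> consec P L'"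
      using R1 unfolding R_def by blast+
    obtain z where z: "z \<in> L \<inter> L'" "fst e $ 1 < z $ 1" "z $ 1 < snd e $ 1"
        "fst f $ 1 < z $ 1" "z $ 1 < snd f $ 1"
      using R1 unfolding R_def by blast
    \<comment> \<open>A common endpoint would be the meeting point \<open>z\<close> of the lines,
      but \<open>z\<close> is interior to both segments; so the four endpoints are distinct.\<close>
    have off: "p \<notin> L'" if "p \<in> L" "p \<noteq> z" for p
      using lines_eq[of L L' p z] that z L Lam by auto
    have "fst e \<noteq> z" "snd e \<noteq> z" "fst f \<noteq> z" "snd f \<noteq> z" using z by auto
    then have "fst e \<notin> L'" "snd e \<notin> L'" "fst f \<in> L'" "snd f \<in> L'" "fst e \<noteq> snd e" "fst f \<noteq> snd f"
      using off[of "fst e"] off[of "snd e"] e f by (auto simp: consec_def)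
    then have "fst e \<noteq> snd e" "fst e \<noteq> fst f" "fst e \<noteq> snd f" "snd e \<noteq> fst f" "snd e \<noteq> snd f"
      "fst f \<noteq> snd f" by metis+
    then show "card {fst e, snd e, fst f, snd f} = 4" by simp
  qed (use finE E_props in blast)+
  moreover have "card \<Lambda> * j * q ^ 2 \<le> card E * q ^ 2" using E by simp
  ultimately show ?thesis using C by linarith
qed

section \<open>Counting rich lines\<close>

lemma vertical_line:
  assumes "is_line L" "\<not> nonvertical L"
  shows "\<exists>a. L = {p. p $ 1 = a}"
proof -
  obtain p q where pq: "p \<in> L" "q \<in> L" "p \<noteq> q" "p $ 1 = q $ 1"
    using assms by (auto simp: nonvertical_def inj_on_def)
  then have "L = affine hull {p, q}" using assms line_eq_hull by auto
  moreover have "q $ 2 \<noteq> p $ 2" using pq vec2_eqI by metis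
  ultimately have "L = {r. r $ 1 = p $ 1}"
    using pq by (auto simp: mem_line_iff_cross cross_def)
  then show ?thesis by blast
qed

definition rich_lines :: "(real ^ 2) set \<Rightarrow> nat \<Rightarrow> (real ^ 2) set set" where
  "rich_lines P k = {L. is_line L \<and> k \<le> card (P \<inter> L)}"

lemma line_through_two:
  assumes "is_line L" "2 \<le> card (P \<inter> L)"
  obtains p q where "p \<in> P" "q \<in> P" "p \<noteq> q" "L = affine hull {p, q}"
proof -
  have "\<not> card (P \<inter> L) \<le> Suc 0" using assms by simp
  moreover have "finite (P \<inter> L)" using assms by (intro card_ge_0_finite) simp
  ultimately obtain p q where "p \<in> P \<inter> L" "q \<in> P \<inter> L" "p \<noteq> q"
    by (auto simp: card_le_Suc0_iff_eq)
  then show thesis using that[of p q] line_eq_hull[of L p q] assms by auto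
qed

lemma finite_rich_lines:
  assumes "finite P" "2 \<le> k"
  shows "finite (rich_lines P k)"
proof (rule finite_subset)
  show "rich_lines P k \<subseteq> (\<lambda>(p, q). affine hull {p, q}) ` (P \<times> P)"
  proof
    fix L assume "L \<in> rich_lines P k"
    then have "is_line L" "2 \<le> card (P \<inter> L)" using assms by (auto simp: rich_lines_def)
    then obtain p q where "p \<in> P" "q \<in> P" "L = affine hull {p, q}"
      by (rule line_through_two)
    then show "L \<in> (\<lambda>(p, q). affine hull {p, q}) ` (P \<times> P)"
      by (intro image_eqI[of _ _ "(p, q)"]) auto
  qed
qed (use assms in auto)

text \<open>Optimisation over \<open>q\<close>: if \<open>M * j\<close> is at most
  \<open>6 * n\<close>, the linear term suffices; otherwise a positive \<open>q\<close> can be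
  chosen that makes the quadratic term suffice.\<close>

lemma szemeredi_trotter_aux:
  fixes M n j :: nat
  assumes j: "0 < j" and n: "0 < n"
    and bound: "\<And>q. 0 < q \<Longrightarrow> M * j * q ^ 2 \<le> 3 * n * q ^ 3 + M ^ 2"
  shows "real M * real j ^ 3 \<le> 6 * real n * real j ^ 2 + 288 * real n ^ 2"
proof (cases "M * j \<le> 6 * n")
  case True
  then have "real M * real j \<le> 6 * real n"
    by (metis of_nat_le_iff of_nat_mult of_nat_numeral)
  then have "real M * real j * real j ^ 2 \<le> 6 * real n * real j ^ 2"
    by (intro mult_right_mono) auto
  moreover have "real M * real j * real j ^ 2 = real M * real j ^ 3"
    by (simp add: power2_eq_square power3_eq_cube)
  moreover have "0 \<le> 288 * real n ^ 2" by simp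
  ultimately show ?thesis by linarith
next
  case False
  \<comment> \<open>The largest \<open>q\<close> for which \<open>3 * n * q ^ 3\<close> is at most
    half of the left side of \<open>bound\<close>.\<close>
  define q where "q = M * j div (6 * n)"
  have q: "0 < q" using False n by (simp add: q_def div_greater_zero_iff)
  have M: "0 < M" using False by (cases M) auto
  have q1: "6 * n * q \<le> M * j" unfolding q_def by (metis mult.commute div_times_less_eq_dividend)
  \<comment> \<open>As \<open>q\<close> is at least 1, rounding down loses at most a factor 2; this
    turns 6 into 12 and leads to \<open>288 = 2 * 12 ^ 2\<close>.\<close>
  have "M * j < 6 * n * Suc q" unfolding q_def using n dividend_less_div_times[of "6 * n" "M * j"]
    by (simp add: algebra_simps)
  also have "\<dots> \<le> 6 * n * (2 * q)" using q by (intro mult_le_mono) auto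
  finally have q2: "M * j \<le> 12 * n * q" by simp
  have "6 * n * q * q ^ 2 \<le> M * j * q ^ 2" using q1 by (intro mult_right_mono) auto
  moreover have "6 * n * q * q ^ 2 = 2 * (3 * n * q ^ 3)"
    by (simp add: power2_eq_square power3_eq_cube)
  ultimately have "M * j * q ^ 2 \<le> 2 * M ^ 2"
    using bound[OF q] by linarith
  then have "M * (j * q ^ 2) \<le> M * (2 * M)"
    by (simp add: power2_eq_square algebra_simps)
  then have q3: "j * q ^ 2 \<le> 2 * M" using M by simp
  have "M * (M * j ^ 3) = j * (M * j) ^ 2" by (simp add: power2_eq_square power3_eq_cube algebra_simps)
  also have "\<dots> \<le> j * (12 * n * q) ^ 2" using q2 by (intro mult_left_mono power_mono) auto
  also have "\<dots> = 144 * n ^ 2 * (j * q ^ 2)" by (simp add: power_mult_distrib)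
  also have "\<dots> \<le> 144 * n ^ 2 * (2 * M)" using q3 by (intro mult_left_mono) auto
  finally have "M * (M * j ^ 3) \<le> M * (288 * n ^ 2)" by (simp add: algebra_simps)
  then have "M * j ^ 3 \<le> 288 * n ^ 2" using M by simp
  then have "real (M * j ^ 3) \<le> real (288 * n ^ 2)" by (rule of_nat_mono)
  then have "real M * real j ^ 3 \<le> 288 * real n ^ 2" by simp
  moreover have "0 \<le> 6 * real n * real j ^ 2" by simp
  ultimately show ?thesis by linarith
qed

text \<open>\<open>incidence_bound\<close> treats the nonvertical lines. The vertical ones are
  pairwise disjoint, so at most \<open>card P / j\<close> of them are rich; they raise the
  coefficient 6 to 7.\<close>

lemma szemeredi_trotter:
  assumes P: "finite P" and j: "0 < j"
  shows "real (card (rich_lines P (Suc j))) * real j ^ 3 \<le>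
    7 * real (card P) * real j ^ 2 + 288 * real (card P) ^ 2"
proof (cases "P = {}")
  case True
  then show ?thesis by (simp add: rich_lines_def)
next
  case False
  define N where "N = {L \<in> rich_lines P (Suc j). nonvertical L}"
  define V where "V = {L \<in> rich_lines P (Suc j). \<not> nonvertical L}"
  have fin: "finite (rich_lines P (Suc j))" using P j by (intro finite_rich_lines) auto
  have finN: "finite N" using fin by (simp add: N_def)
  have n: "0 < card P" using P False by (simp add: card_gt_0_iff)
  have "card N * j * q ^ 2 \<le> 3 * card P * q ^ 3 + card N ^ 2" if "0 < q" for q
    using finN that by (intro incidence_bound P) (auto simp: N_def rich_lines_def)
  then have N: "real (card N) * real j ^ 3 \<le> 6 * real (card P) * real j ^ 2 + 288 * real (card P) ^ 2"
    by (rule szemeredi_trotter_aux[OF j n])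
  have "card V * j = (\<Sum>L\<in>V. j)" by simp
  also have "\<dots> \<le> (\<Sum>L\<in>V. card (P \<inter> L))"
    by (intro sum_mono) (auto simp: V_def rich_lines_def)
  also have "\<dots> = card (\<Union>L\<in>V. P \<inter> L)"
  proof (rule card_UN_disjoint[symmetric])
    show "\<forall>L\<in>V. \<forall>L'\<in>V. L \<noteq> L' \<longrightarrow> P \<inter> L \<inter> (P \<inter> L') = {}"
    proof (intro ballI impI)
      fix L L' assume L: "L \<in> V" "L' \<in> V" "L \<noteq> L'"
      obtain a b where "L = {p. p $ 1 = a}" "L' = {p. p $ 1 = b}"
        using vertical_line[of L] vertical_line[of L'] L by (auto simp: V_def rich_lines_def)
      then show "P \<inter> L \<inter> (P \<inter> L') = {}" using L by auto
    qed
  qed (use fin P in \<open>auto simp: V_def\<close>)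
  also have "\<dots> \<le> card P" using P by (intro card_mono) auto
  finally have "real (card V * j) \<le> real (card P)" by (rule of_nat_mono)
  then have V: "real (card V) * real j ^ 3 \<le> real (card P) * real j ^ 2"
    using mult_right_mono[of "real (card V * j)" "real (card P)" "real j ^ 2"]
    by (simp add: power2_eq_square power3_eq_cube algebra_simps)
  have "card (rich_lines P (Suc j)) = card N + card V"
    using fin by (subst card_Un_disjoint[symmetric]) (auto simp: N_def V_def intro: arg_cong[where f=card])
  then show ?thesis using N V by (simp add: algebra_simps)
qed

section \<open>Counting pairs of points on rich lines\<close>

lemma sum_inverse_squares_le:
  assumes "2 \<le> d"
  shows "(\<Sum>j\<in>{d..<K}. 1 / real j ^ 2) \<le> 1 / (real d - 1)"
proof -
  \<comment> \<open>The induction needs the telescoped form, comparing \<open>1 / k ^ 2\<close> with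
    \<open>1 / (k - 1) - 1 / k\<close>.\<close>
  have "(\<Sum>j\<in>{d..<K}. 1 / real j ^ 2) \<le> 1 / (real d - 1) - 1 / (real K - 1)" if "d \<le> K"
    using that
  proof (induction K rule: dec_induct)
    case (step k)
    have k: "real k > 1" using step assms by simp
    have "1 / real k ^ 2 \<le> 1 / (real k * (real k - 1))"
      using k by (intro divide_left_mono) (auto simp: power2_eq_square)
    also have "\<dots> = 1 / (real k - 1) - 1 / real k" using k by (simp add: field_simps)
    finally show ?case using step by simp
  qed simp
  moreover have "1 / (real K - 1) \<ge> 0" if "d \<le> K" using that assms by simp
  moreover have "0 \<le> 1 / (real d - 1)" using assms by simp
  ultimately show ?thesis by (cases "d \<le> K") (linarith, simp)
qed

text \<open>Spreads the squared size of a rich line over levels \<open>j\<close>, so that sums over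
  lines and levels can be exchanged. The factor 4 absorbs the missing levels below \<open>d\<close>,
  which is less than half of \<open>m\<close>.\<close>

lemma square_le_sum:
  fixes d m :: nat
  assumes "0 < d" "2 * d < m"
  shows "m ^ 2 \<le> 4 * (\<Sum>j\<in>{d..<m}. j)"
proof -
  have sum: "2 * (\<Sum>j\<in>{d..<d + k}. j) + k = k * (2 * d + k)" for k
    by (induction k) (auto simp: algebra_simps)
  define i where "i = m - 2 * d - 1"
  have m: "m = d + (d + 1 + i)" using assms by (simp add: i_def)
  obtain e where d: "d = Suc e" using assms by (cases d) auto
  have "m ^ 2 + 2 * (d + 1 + i) \<le> 2 * ((d + 1 + i) * (2 * d + (d + 1 + i)))"
    unfolding m d by (simp add: power2_eq_square algebra_simps)
  then show ?thesis using sum[of "d + 1 + i"] m by simp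
qed

definition rich_pairs :: "nat \<Rightarrow> (real ^ 2) set \<Rightarrow> seg set" where
  "rich_pairs c P = {(p, q). p \<in> P \<and> q \<in> P \<and> p \<noteq> q \<and> c < card (P \<inter> affine hull {p, q})}"

text \<open>The squared sizes of the rich lines bound the number of rich pairs. Spread over levels
  and summed over lines first, they leave \<open>j\<close> times the number of lines with more than
  \<open>j\<close> points, to which \<open>szemeredi_trotter\<close> applies. The linear term occurs
  on at most \<open>K\<close> levels; the quadratic one is summed against
  \<open>1 / j ^ 2\<close>.\<close>

lemma card_rich_pairs:
  assumes P: "finite P" and d: "2 \<le> d"
    and K: "\<And>L. is_line L \<Longrightarrow> card (P \<inter> L) \<le> K"
  shows "real (card (rich_pairs (2 * d) P)) \<le>
    28 * real (card P) * real K + 1152 * real (card P) ^ 2 / (real d - 1)"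
proof -
  define n where "n = card P"
  define \<Lambda> where "\<Lambda> = rich_lines P (Suc (2 * d))"
  define m where "m L = card (P \<inter> L)" for L
  have fin: "finite \<Lambda>" unfolding \<Lambda>_def using P d by (intro finite_rich_lines) auto
  have "rich_pairs (2 * d) P \<subseteq> (\<Union>L\<in>\<Lambda>. (P \<inter> L) \<times> (P \<inter> L))"
  proof
    fix x assume "x \<in> rich_pairs (2 * d) P"
    then obtain p q where x: "x = (p, q)" "p \<in> P" "q \<in> P" "p \<noteq> q"
      "2 * d < card (P \<inter> affine hull {p, q})" by (auto simp: rich_pairs_def)
    then have "affine hull {p, q} \<in> \<Lambda>" by (auto simp: \<Lambda>_def rich_lines_def is_line_hull)
    moreover have "p \<in> affine hull {p, q}" "q \<in> affine hull {p, q}" by (auto simp: hull_inc)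
    ultimately show "x \<in> (\<Union>L\<in>\<Lambda>. (P \<inter> L) \<times> (P \<inter> L))" using x by blast
  qed
  then have "card (rich_pairs (2 * d) P) \<le> card (\<Union>L\<in>\<Lambda>. (P \<inter> L) \<times> (P \<inter> L))"
    using fin P by (intro card_mono) auto
  also have "\<dots> \<le> (\<Sum>L\<in>\<Lambda>. card ((P \<inter> L) \<times> (P \<inter> L)))" using fin by (rule card_UN_le)
  also have "\<dots> = (\<Sum>L\<in>\<Lambda>. m L ^ 2)" by (simp add: m_def card_cartesian_product power2_eq_square)
  also have "\<dots> \<le> (\<Sum>L\<in>\<Lambda>. 4 * (\<Sum>j\<in>{d..<m L}. j))"
    using d by (intro sum_mono square_le_sum) (auto simp: \<Lambda>_def rich_lines_def m_def)
  also have "\<dots> = (\<Sum>L\<in>\<Lambda>. 4 * (\<Sum>j\<in>{d..<K}. if j < m L then j else 0))"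
  proof (rule sum.cong)
    fix L assume "L \<in> \<Lambda>"
    then have "m L \<le> K" using K by (auto simp: \<Lambda>_def rich_lines_def m_def)
    then have "{j \<in> {d..<K}. j < m L} = {d..<m L}" by auto
    then show "4 * (\<Sum>j\<in>{d..<m L}. j) = 4 * (\<Sum>j\<in>{d..<K}. if j < m L then j else 0)"
      by (simp add: sum.inter_filter[symmetric])
  qed simp
  also have "\<dots> = 4 * (\<Sum>j\<in>{d..<K}. \<Sum>L\<in>\<Lambda>. if j < m L then j else 0)"
    by (subst sum.swap) (simp add: sum_distrib_left)
  also have "\<dots> \<le> 4 * (\<Sum>j\<in>{d..<K}. j * card (rich_lines P (Suc j)))"
  proof (intro mult_left_mono sum_mono)
    fix j assume j: "j \<in> {d..<K}"
    have "(\<Sum>L\<in>\<Lambda>. if j < m L then j else 0) = j * card {L \<in> \<Lambda>. j < m L}"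
      using fin by (simp add: sum.inter_filter[symmetric])
    also have "\<dots> \<le> j * card (rich_lines P (Suc j))"
      using j d P by (intro mult_left_mono card_mono finite_rich_lines)
        (auto simp: \<Lambda>_def rich_lines_def m_def)
    finally show "(\<Sum>L\<in>\<Lambda>. if j < m L then j else 0) \<le> j * card (rich_lines P (Suc j))" .
  qed simp
  finally have "real (card (rich_pairs (2 * d) P)) \<le>
      real (4 * (\<Sum>j\<in>{d..<K}. j * card (rich_lines P (Suc j))))" by (rule of_nat_mono)
  also have "\<dots> = 4 * (\<Sum>j\<in>{d..<K}. real j * real (card (rich_lines P (Suc j))))" by simp
  also have "\<dots> \<le> 4 * (\<Sum>j\<in>{d..<K}. 7 * real n + 288 * real n ^ 2 * (1 / real j ^ 2))"
  proof (intro mult_left_mono sum_mono)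
    fix j assume "j \<in> {d..<K}"
    then have j: "0 < real j" using d by auto
    have "real j * real (card (rich_lines P (Suc j))) * real j ^ 2 \<le>
        7 * real n * real j ^ 2 + 288 * real n ^ 2"
      using szemeredi_trotter[OF P, of j] j
      by (simp add: n_def power2_eq_square power3_eq_cube algebra_simps)
    also have "\<dots> = (7 * real n + 288 * real n ^ 2 * (1 / real j ^ 2)) * real j ^ 2"
      using j by (simp add: algebra_simps)
    finally show "real j * real (card (rich_lines P (Suc j))) \<le> 7 * real n + 288 * real n ^ 2 * (1 / real j ^ 2)"
      using j by (simp add: mult_le_cancel_right)
  qed simp
  also have "\<dots> = 28 * real n * real (K - d) + 1152 * real n ^ 2 * (\<Sum>j\<in>{d..<K}. 1 / real j ^ 2)"
    by (simp only: sum.distrib sum_distrib_left[symmetric]) (simp add: algebra_simps)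
  also have "\<dots> \<le> 28 * real n * real K + 1152 * real n ^ 2 * (1 / (real d - 1))"
    using sum_inverse_squares_le[OF d, of K] by (intro add_mono mult_left_mono) auto
  finally show ?thesis by (simp add: n_def)
qed

section \<open>The Sylvester--Gallai theorem\<close>

definition sqlen :: "real ^ 2 \<Rightarrow> real ^ 2 \<Rightarrow> real" where
  "sqlen a b = (b $ 1 - a $ 1) ^ 2 + (b $ 2 - a $ 2) ^ 2"

lemma sqlen_pos: "a \<noteq> b \<Longrightarrow> 0 < sqlen a b"
  using vec2_eqI[of a b] by (auto simp: sqlen_def sum_power2_gt_zero_iff)

lemma noncollinear_point_off_line:
  assumes "\<not> collinear Q"
  shows "\<exists>a\<in>Q. \<exists>b\<in>Q. \<exists>p\<in>Q. a \<noteq> b \<and> p \<notin> affine hull {a, b}"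
proof -
  have "\<exists>a\<in>Q. \<exists>b\<in>Q. a \<noteq> b"
  proof (rule ccontr)
    assume "\<not> ?thesis"
    then obtain x where "Q \<subseteq> {x}" by blast
    then show False using assms collinear_subset[of "{x}" Q] by simp
  qed
  then obtain a b where ab: "a \<in> Q" "b \<in> Q" "a \<noteq> b" by blast
  moreover have "\<not> Q \<subseteq> affine hull {a, b}"
    using assms collinear_subset[of "affine hull {a, b}" Q] by (auto simp: collinear_affine_hull_collinear)
  ultimately show ?thesis by blast
qed

text \<open>Kelly's argument: a point and a connecting line not through it at minimal positive distance;
  if the line had three points, two of them would lie on the same side of the foot of the
  perpendicular, and the nearer one is even closer to the line through the other and the point.\<close>

theorem sylvester_gallai:
  fixes Q :: "(real ^ 2) set"
  assumes Q: "finite Q" "\<not> collinear Q"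
  shows "\<exists>a\<in>Q. \<exists>b\<in>Q. a \<noteq> b \<and> Q \<inter> affine hull {a, b} = {a, b}"
proof -
  \<comment> \<open>The squared distance of \<open>p\<close> from the line through \<open>a\<close>
    and \<open>b\<close>: squared doubled area over squared base.\<close>
  define dst2 where "dst2 = (\<lambda>(p, a, b). cross a b p ^ 2 / sqlen a b)"
  define Tri where "Tri = {(p, a, b). p \<in> Q \<and> a \<in> Q \<and> b \<in> Q \<and> a \<noteq> b \<and> cross a b p \<noteq> 0}"
  have "finite Tri"
    using Q by (intro finite_subset[of Tri "Q \<times> Q \<times> Q"]) (auto simp: Tri_def)
  moreover obtain a0 b0 p0 where "a0 \<in> Q" "b0 \<in> Q" "p0 \<in> Q" "a0 \<noteq> b0" "p0 \<notin> affine hull {a0, b0}"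
    using noncollinear_point_off_line[OF Q(2)] by blast
  then have "(p0, a0, b0) \<in> Tri" by (simp add: Tri_def mem_line_iff_cross)
  then have "Tri \<noteq> {}" by blast
  ultimately obtain x where x: "x \<in> Tri" "\<And>y. y \<in> Tri \<Longrightarrow> dst2 x \<le> dst2 y"
    using ex_is_arg_min_if_finite[of Tri dst2] by (auto simp: is_arg_min_linorder)
  obtain p a b where x_eq: "x = (p, a, b)" by (cases x)
  have pab: "p \<in> Q" "a \<in> Q" "b \<in> Q" "a \<noteq> b" "cross a b p \<noteq> 0"
    using x(1) by (auto simp: Tri_def x_eq)
  have "Q \<inter> affine hull {a, b} = {a, b}"
  proof (rule ccontr)
    assume "\<not> ?thesis"
    then obtain r where r: "r \<in> Q" "r \<in> affine hull {a, b}" "r \<noteq> a" "r \<noteq> b"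
      using pab by (auto simp: hull_inc)
    then obtain \<tau> where \<tau>: "r = a + \<tau> *\<^sub>R (b - a)" by (auto simp: mem_line_iff_param)
    define pt where "pt t = a + t *\<^sub>R (b - a)" for t
    have pt: "pt 0 = a" "pt 1 = b" "pt \<tau> = r" by (auto simp: pt_def \<tau>)
    have neq: "\<tau> \<noteq> 0" "\<tau> \<noteq> 1" using r \<tau> by auto
    \<comment> \<open>The inner product of \<open>b - a\<close> and \<open>pt s - p\<close>; its
      sign tells on which side of the foot of the perpendicular from \<open>p\<close> the point
      \<open>pt s\<close> lies.\<close>
    define g where "g s = (b $ 1 - a $ 1) * (pt s $ 1 - p $ 1) + (b $ 2 - a $ 2) * (pt s $ 2 - p $ 2)" for s
    have "\<exists>s1 s2 s3. s1 < s2 \<and> s2 < s3 \<and> pt s1 \<in> Q \<and> pt s2 \<in> Q \<and> pt s3 \<in> Q"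
    proof -
      consider "\<tau> < 0" | "0 < \<tau>" "\<tau> < 1" | "1 < \<tau>" using neq by linarith
      then show ?thesis
      proof cases
        case 1
        then show ?thesis using pt pab r by (intro exI[of _ \<tau>] exI[of _ 0] exI[of _ 1]) auto
      next
        case 2
        then show ?thesis using pt pab r by (intro exI[of _ 0] exI[of _ \<tau>] exI[of _ 1]) auto
      next
        case 3
        then show ?thesis using pt pab r by (intro exI[of _ 0] exI[of _ 1] exI[of _ \<tau>]) auto
      qed
    qed
    then obtain s1 s2 s3 where s: "s1 < s2" "s2 < s3" "pt s1 \<in> Q" "pt s2 \<in> Q" "pt s3 \<in> Q" by blast
    \<comment> \<open>From the middle point, one of the outer points lies in the direction away from
      the foot.\<close>
    have "\<exists>s t. s \<noteq> t \<and> pt s \<in> Q \<and> pt t \<in> Q \<and> 0 \<le> (t - s) * g s"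
    proof (cases "0 \<le> g s2")
      case True
      then show ?thesis using s by (intro exI[of _ s2] exI[of _ s3]) auto
    next
      case False
      then show ?thesis using s by (intro exI[of _ s2] exI[of _ s1]) (auto simp: mult_nonpos_nonpos)
    qed
    then obtain s t where st: "s \<noteq> t" "pt s \<in> Q" "pt t \<in> Q" "0 \<le> (t - s) * g s" by blast
    define y z where "y = pt s" and "z = pt t"
    have comp: "pt u $ i = a $ i + u * (b $ i - a $ i)" for u i by (simp add: pt_def)
    have len_yz: "sqlen y z = (s - t) ^ 2 * sqlen a b"
      by (simp add: sqlen_def y_def z_def comp power2_eq_square algebra_simps)
    have cross_eq: "cross p z y = (s - t) * cross a b p"
      by (simp add: cross_def y_def z_def comp algebra_simps)
    then have cross0: "cross p z y \<noteq> 0" using st pab by simp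
    then have "p \<noteq> y" "p \<noteq> z" by (auto simp: cross_def)
    \<comment> \<open>The law of cosines at \<open>y\<close>, where the angle is not acute.\<close>
    have "sqlen p z = sqlen y z + 2 * ((t - s) * g s) + sqlen p y"
      by (simp add: sqlen_def g_def y_def z_def comp power2_eq_square algebra_simps)
    then have less: "sqlen y z < sqlen p z"
      using st sqlen_pos[OF \<open>p \<noteq> y\<close>] by linarith
    have pos: "0 < sqlen y z" using len_yz st sqlen_pos[OF pab(4)] by simp
    have "(y, p, z) \<in> Tri" using cross0 \<open>p \<noteq> z\<close> st pab by (simp add: Tri_def y_def z_def)
    then have "dst2 (p, a, b) \<le> cross p z y ^ 2 / sqlen p z"
      using x(2) by (force simp: dst2_def x_eq)
    \<comment> \<open>The same area over a longer base: \<open>y\<close> is nearer to the line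
      through \<open>p\<close> and \<open>z\<close> than \<open>p\<close> is to the line through
      \<open>a\<close> and \<open>b\<close>.\<close>
    also have "\<dots> < cross p z y ^ 2 / sqlen y z"
      using less pos cross0 by (intro divide_strict_left_mono) auto
    also have "\<dots> = dst2 (p, a, b)"
      using st by (simp add: len_yz cross_eq dst2_def power_mult_distrib)
    finally show False by simp
  qed
  then show ?thesis using pab by blast
qed

section \<open>Ordinary triangles\<close>

lemma finite_ordinary_triangles: "finite P \<Longrightarrow> finite {T. ordinary_triangle c P T}"
  by (rule finite_subset[of _ "Pow P"]) (auto simp: ordinary_triangle_def)

lemma ordinary_triangleI:
  assumes "finite P" "a \<in> P" "b \<in> P" "p \<in> P" "a \<noteq> b" "p \<notin> affine hull {a, b}"
    and "card (P \<inter> affine hull {a, b}) \<le> c" "card (P \<inter> affine hull {a, p}) \<le> c"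
      "card (P \<inter> affine hull {b, p}) \<le> c"
  shows "ordinary_triangle c P {a, b, p}"
proof -
  have "p \<noteq> a" "p \<noteq> b" using assms(6) by (auto simp: hull_inc)
  moreover have "\<not> collinear {a, b, p}"
    using assms by (simp add: collinear_3_affine_hull)
  ultimately show ?thesis
    using assms unfolding ordinary_triangle_def by (auto simp: insert_commute)
qed

text \<open>Every ordered triple has equal first entries, or its third entry on the line of the
  first two, or a rich pair in one of three positions, or all entries in one ordinary triangle. Each
  triangle accounts for at most 27 triples.\<close>

lemma cube_card_le_triangles:
  assumes P: "finite P" and K: "\<And>L. is_line L \<Longrightarrow> card (P \<inter> L) \<le> K"
  shows "card P ^ 3 \<le> card P ^ 2 + card P ^ 2 * K + 3 * (card (rich_pairs c P) * card P)
    + 27 * card {T. ordinary_triangle c P T}"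
proof -
  define R where "R = rich_pairs c P"
  define D where "D = (\<lambda>(a, b). (a, a, b)) ` (P \<times> P)"
  define C where "C = (\<lambda>((a, b), p). (a, b, p)) ` (SIGMA ab : {(a, b). a \<in> P \<and> b \<in> P \<and> a \<noteq> b}. P \<inter> affine hull {fst ab, snd ab})"
  define R1 where "R1 = (\<lambda>((a, b), p). (a, b, p)) ` (R \<times> P)"
  define R2 where "R2 = (\<lambda>((a, b), p). (a, p, b)) ` (R \<times> P)"
  define R3 where "R3 = (\<lambda>((a, b), p). (p, a, b)) ` (R \<times> P)"
  define U where "U = (\<Union>T\<in>{T. ordinary_triangle c P T}. T \<times> T \<times> T)"
  have "R \<subseteq> P \<times> P" by (auto simp: R_def rich_pairs_def)
  then have finR: "finite R" using P by (meson finite_SigmaI finite_subset)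
  have finT: "finite {T. ordinary_triangle c P T}" using P by (rule finite_ordinary_triangles)
  have finpairs: "finite {(a, b). a \<in> P \<and> b \<in> P \<and> a \<noteq> b}"
    using P by (rule_tac finite_subset[of _ "P \<times> P"]) auto
  have cover: "P \<times> P \<times> P \<subseteq> D \<union> (C \<union> (R1 \<union> (R2 \<union> (R3 \<union> U))))"
  proof
    fix x assume "x \<in> P \<times> P \<times> P"
    then obtain a b p where x: "x = (a, b, p)" "a \<in> P" "b \<in> P" "p \<in> P" by auto
    have D: "x \<in> D" if "a = b" using x that by (auto simp: D_def)
    have C: "x \<in> C" if "a \<noteq> b" "p \<in> affine hull {a, b}"
      unfolding C_def x using x that by (intro image_eqI[of _ _ "((a, b), p)"]) auto
    have R1: "x \<in> R1" if "(a, b) \<in> R"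
      unfolding R1_def x using x that by (intro image_eqI[of _ _ "((a, b), p)"]) auto
    have R2: "x \<in> R2" if "(a, p) \<in> R"
      unfolding R2_def x using x that by (intro image_eqI[of _ _ "((a, p), b)"]) auto
    have R3: "x \<in> R3" if "(b, p) \<in> R"
      unfolding R3_def x using x that by (intro image_eqI[of _ _ "((b, p), a)"]) auto
    have U: "x \<in> U" if "a \<noteq> b" "p \<notin> affine hull {a, b}" "(a, b) \<notin> R" "(a, p) \<notin> R" "(b, p) \<notin> R"
    proof -
      have "p \<noteq> a" "p \<noteq> b" using that(2) by (auto simp: hull_inc)
      then have "ordinary_triangle c P {a, b, p}"
        using that x P by (intro ordinary_triangleI) (auto simp: R_def rich_pairs_def)
      then show ?thesis unfolding U_def x by blast
    qed
    show "x \<in> D \<union> (C \<union> (R1 \<union> (R2 \<union> (R3 \<union> U))))" using D C R1 R2 R3 U by blast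
  qed
  have "finite (D \<union> (C \<union> (R1 \<union> (R2 \<union> (R3 \<union> U)))))"
    using P finR finT finpairs
    by (auto simp: D_def C_def R1_def R2_def R3_def U_def ordinary_triangle_def
        intro!: finite_imageI finite_SigmaI intro: finite_subset)
  with cover have "card (P \<times> P \<times> P) \<le> card (D \<union> (C \<union> (R1 \<union> (R2 \<union> (R3 \<union> U)))))"
    by (rule card_mono[rotated])
  also have "\<dots> \<le> card D + (card C + (card R1 + (card R2 + (card R3 + card U))))"
    by (meson add_left_mono card_Un_le order_trans)
  also have "card D \<le> card P ^ 2"
    unfolding D_def using card_image_le[of "P \<times> P"] P
    by (simp add: card_cartesian_product power2_eq_square)
  also have "card C \<le> card P ^ 2 * K"
  proof -
    have "card C \<le> card (SIGMA ab : {(a, b). a \<in> P \<and> b \<in> P \<and> a \<noteq> b}. P \<inter> affine hull {fst ab, snd ab})"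
      unfolding C_def using P finpairs by (intro card_image_le finite_SigmaI) auto
    also have "\<dots> = (\<Sum>ab\<in>{(a, b). a \<in> P \<and> b \<in> P \<and> a \<noteq> b}. card (P \<inter> affine hull {fst ab, snd ab}))"
      using P finpairs by (intro card_SigmaI) auto
    also have "\<dots> \<le> (\<Sum>ab\<in>{(a, b). a \<in> P \<and> b \<in> P \<and> a \<noteq> b}. K)"
      using K is_line_hull by (intro sum_mono) auto
    also have "\<dots> = card {(a, b). a \<in> P \<and> b \<in> P \<and> a \<noteq> b} * K" by simp
    also have "\<dots> \<le> card (P \<times> P) * K" using P by (intro mult_right_mono card_mono) auto
    finally show ?thesis by (simp add: card_cartesian_product power2_eq_square)
  qed
  also have "card R1 \<le> card R * card P"
    unfolding R1_def using card_image_le[of "R \<times> P"] P finR by (simp add: card_cartesian_product)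
  also have "card R2 \<le> card R * card P"
    unfolding R2_def using card_image_le[of "R \<times> P"] P finR by (simp add: card_cartesian_product)
  also have "card R3 \<le> card R * card P"
    unfolding R3_def using card_image_le[of "R \<times> P"] P finR by (simp add: card_cartesian_product)
  also have "card U \<le> (\<Sum>T\<in>{T. ordinary_triangle c P T}. card (T \<times> T \<times> T))"
    unfolding U_def using finT by (rule card_UN_le)
  also have "\<dots> = 27 * card {T. ordinary_triangle c P T}"
    by (simp add: card_cartesian_product ordinary_triangle_def)
  finally show ?thesis
    by (simp add: R_def card_cartesian_product power3_eq_cube algebra_simps)
qed

section \<open>Triangles with one vertex on a rich line\<close>

lemma card_line_inter_line_le:
  assumes "is_line L" "is_line L'" "L \<noteq> L'"
  shows "card (P \<inter> L \<inter> L') \<le> 1"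
proof (cases "finite (P \<inter> L \<inter> L')")
  case True
  then show ?thesis using lines_eq[OF assms(1,2)] assms(3) by (auto simp: card_le_Suc0_iff_eq)
qed simp

text \<open>The lines from \<open>x\<close> to distinct points of \<open>L\<close> meet only in
  \<open>x\<close>, so their other points are counted only once.\<close>

lemma card_rich_directions:
  assumes P: "finite P" and L: "is_line L" and x: "x \<notin> L"
  shows "c * card {p \<in> P \<inter> L. c < card (P \<inter> affine hull {x, p})} \<le> card P"
proof -
  define B where "B = {p \<in> P \<inter> L. c < card (P \<inter> affine hull {x, p})}"
  define W where "W p = P \<inter> affine hull {x, p} - {x}" for p
  have "c * card B = (\<Sum>p\<in>B. c)" by simp
  also have "\<dots> \<le> (\<Sum>p\<in>B. card (W p))"
  proof (rule sum_mono)
    fix p assume "p \<in> B"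
    then have "c < card (P \<inter> affine hull {x, p})" by (simp add: B_def)
    \<comment> \<open>Removing \<open>x\<close> loses at most one point, so more than
      \<open>c\<close> points leave at least \<open>c\<close>.\<close>
    also have "\<dots> \<le> Suc (card (W p))"
      unfolding W_def using P card_Suc_Diff1[of "P \<inter> affine hull {x, p}" x]
      by (cases "x \<in> P \<inter> affine hull {x, p}") auto
    finally show "c \<le> card (W p)" by simp
  qed
  also have "\<dots> = card (\<Union>p\<in>B. W p)"
  proof (rule card_UN_disjoint[symmetric])
    show "\<forall>p\<in>B. \<forall>q\<in>B. p \<noteq> q \<longrightarrow> W p \<inter> W q = {}"
    proof (intro ballI impI, rule ccontr)
      fix p q assume pq: "p \<in> B" "q \<in> B" "p \<noteq> q" "W p \<inter> W q \<noteq> {}"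
      then obtain r where r: "r \<in> affine hull {x, p}" "r \<in> affine hull {x, q}" "r \<noteq> x"
        by (auto simp: W_def)
      have ne: "x \<noteq> p" "x \<noteq> q" using pq x by (auto simp: B_def)
      have "affine hull {x, p} = affine hull {x, q}"
        using lines_eq[OF is_line_hull[OF ne(1)] is_line_hull[OF ne(2)], of x r] r by (auto simp: hull_inc)
      then have "q \<in> affine hull {x, p}" by (auto simp: hull_inc)
      then have "L = affine hull {x, p}"
        using lines_eq[OF L is_line_hull[OF ne(1)], of p q] pq by (auto simp: B_def hull_inc)
      then show False using x by (auto simp: hull_inc)
    qed
  qed (use P in \<open>auto simp: B_def W_def\<close>)
  also have "\<dots> \<le> card P" using P by (intro card_mono) (auto simp: W_def)
  finally show ?thesis by (simp add: B_def)
qed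

text \<open>With \<open>a\<close>, \<open>b\<close> from \<open>sylvester_gallai\<close>, a point of
  \<open>P \<inter> L\<close> fails to complete a triangle only if it lies on \<open>M\<close> or in
  a rich direction from \<open>a\<close> or \<open>b\<close>. The first excludes at most one point,
  the others at most \<open>card P / c\<close> each.\<close>

lemma triangles_on_rich_line:
  assumes P: "finite P" and L: "is_line L" and off: "\<not> collinear (P - L)" and c: "3 \<le> c"
  shows "c * card (P \<inter> L) \<le> c + 2 * card P + c * card {T. ordinary_triangle c P T}"
proof -
  obtain a b where ab: "a \<in> P - L" "b \<in> P - L" "a \<noteq> b" "(P - L) \<inter> affine hull {a, b} = {a, b}"
    using sylvester_gallai[OF _ off] P by blast
  define M where "M = affine hull {a, b}"
  define B where "B x = {p \<in> P \<inter> L. c < card (P \<inter> affine hull {x, p})}" for x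
  define G where "G = P \<inter> L - (P \<inter> L \<inter> M \<union> (B a \<union> B b))"
  have "a \<in> M" by (simp add: M_def hull_inc)
  then have "L \<noteq> M" using ab by auto
  then have LM: "card (P \<inter> L \<inter> M) \<le> 1"
    using L ab(3) by (intro card_line_inter_line_le) (auto simp: M_def is_line_hull)
  \<comment> \<open>Besides \<open>a\<close> and \<open>b\<close>, only one point of
    \<open>L\<close> can lie on \<open>M\<close>, so three points are allowed for; hence
    \<open>3 \<le> c\<close>.\<close>
  have "P \<inter> M \<subseteq> {a, b} \<union> (P \<inter> L \<inter> M)" using ab(4) by (auto simp: M_def)
  then have "card (P \<inter> M) \<le> card ({a, b} \<union> (P \<inter> L \<inter> M))" using P by (intro card_mono) auto
  also have "\<dots> \<le> card {a, b} + card (P \<inter> L \<inter> M)" by (rule card_Un_le)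
  also have "\<dots> \<le> c" using LM c ab(3) by simp
  finally have Mc: "card (P \<inter> M) \<le> c" .
  have "(\<lambda>p. {a, b, p}) ` G \<subseteq> {T. ordinary_triangle c P T}"
  proof clarify
    fix p assume "p \<in> G"
    then have p: "p \<in> P" "p \<notin> M" "card (P \<inter> affine hull {a, p}) \<le> c" "card (P \<inter> affine hull {b, p}) \<le> c"
      unfolding G_def B_def by (simp_all add: not_less)
    show "ordinary_triangle c P {a, b, p}"
      using ab(1-3) by (intro ordinary_triangleI[OF P _ _ p(1) _ p(2)[unfolded M_def] Mc[unfolded M_def] p(3,4)]) simp_all
  qed
  moreover have "inj_on (\<lambda>p. {a, b, p}) G"
  proof (rule inj_onI)
    fix p q assume pq: "p \<in> G" "q \<in> G" "{a, b, p} = {a, b, q}"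
    then have "p \<in> {a, b, q}" by blast
    then show "p = q" using pq ab by (auto simp: G_def)
  qed
  ultimately have G: "card G \<le> card {T. ordinary_triangle c P T}"
    using finite_ordinary_triangles[OF P] by (intro card_inj_on_le)
  have "card (P \<inter> L) \<le> card G + card (P \<inter> L \<inter> M \<union> (B a \<union> B b))"
    unfolding G_def using P diff_card_le_card_Diff[of "P \<inter> L \<inter> M \<union> (B a \<union> B b)" "P \<inter> L"]
    by (simp add: B_def)
  also have "\<dots> \<le> card G + (1 + (card (B a) + card (B b)))"
    using card_Un_le[of "P \<inter> L \<inter> M" "B a \<union> B b"] card_Un_le[of "B a" "B b"] LM by linarith
  finally have "c * card (P \<inter> L) \<le> c * (card G + (1 + (card (B a) + card (B b))))"
    by (rule mult_left_mono) simp
  also have "\<dots> = c * card G + c + c * card (B a) + c * card (B b)" by (simp add: algebra_simps)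
  also have "c * card G \<le> c * card {T. ordinary_triangle c P T}" using G by (rule mult_left_mono) simp
  also have "c * card (B a) \<le> card P"
    unfolding B_def using ab by (intro card_rich_directions P L) auto
  also have "c * card (B b) \<le> card P"
    unfolding B_def using ab by (intro card_rich_directions P L) auto
  finally show ?thesis by simp
qed

section \<open>Combining the cases\<close>

lemma collinear_subset_line:
  fixes Q :: "(real ^ 2) set"
  assumes "collinear Q"
  shows "\<exists>L. is_line L \<and> Q \<subseteq> L"
proof -
  obtain u v where uv: "Q \<subseteq> affine hull {u, v}" using assms by (auto simp: collinear_affine_hull)
  show ?thesis
  proof (cases "u = v")
    case False
    then show ?thesis using uv is_line_hull by blast
  next
    case True
    \<comment> \<open>The hull is the single point \<open>u\<close>, so any line through
      \<open>u\<close> will do.\<close>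
    have "u \<noteq> u + axis 1 1" by (simp add: axis_eq_0_iff)
    moreover have "Q \<subseteq> affine hull {u, u + axis 1 1}"
      using uv True by (auto simp: hull_inc)
    ultimately show ?thesis using is_line_hull by blast
  qed
qed

text \<open>No line can contain more than \<open>c\<close> points, so any three non-collinear points
  work.\<close>

lemma triangle_if_small:
  assumes P: "finite P" "\<not> collinear P" "card P \<le> c"
  shows "\<exists>T. ordinary_triangle c P T"
proof -
  obtain a b p where "a \<in> P" "b \<in> P" "p \<in> P" "a \<noteq> b" "p \<notin> affine hull {a, b}"
    using noncollinear_point_off_line P by blast
  moreover have "card (P \<inter> S) \<le> c" for S
    using P card_mono[of P "P \<inter> S"] by auto
  ultimately show ?thesis using P(1) ordinary_triangleI by blast
qed

text \<open>In \<open>cube_card_le_triangles\<close> all terms but the last are small against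
  \<open>card P ^ 3\<close>. A cubic number of triangles remains, of which the conclusion keeps only
  \<open>card P\<close>.\<close>

lemma many_triangles_if_lines_small:
  assumes P: "finite P" and n: "80000 < card P"
    and small: "\<And>L. is_line L \<Longrightarrow> 10000 * card (P \<inter> L) < card P"
  shows "card P \<le> card {T. ordinary_triangle 80000 P T}"
proof -
  define N where "N = real (card P)"
  define K where "K = card P div 10000"
  define R where "R = real (card (rich_pairs 80000 P))"
  define T where "T = real (card {T. ordinary_triangle 80000 P T})"
  have lineK: "card (P \<inter> L) \<le> K" if "is_line L" for L
    using small[OF that] by (simp add: K_def)
  have N: "80000 \<le> N" using n by (simp add: N_def)
  have K: "10000 * real K \<le> N"
    unfolding N_def K_def by (metis (no_types) div_times_less_eq_dividend mult.commute of_nat_le_iff of_nat_mult of_nat_numeral)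
  \<comment> \<open>Here \<open>d = 40000\<close>, because the threshold 80000 is
    \<open>2 * d\<close>; 39999 is \<open>d - 1\<close>.\<close>
  have "R \<le> 28 * N * real K + 1152 * N ^ 2 / 39999"
    using card_rich_pairs[OF P, of 40000 K] lineK by (simp add: R_def N_def)
  also have "28 * N * real K \<le> 28 * N * (N / 10000)" using K N by (intro mult_left_mono) auto
  finally have "R \<le> (28 / 10000 + 1152 / 39999) * N ^ 2" by (simp add: power2_eq_square field_simps)
  also have "\<dots> \<le> 1 / 20 * N ^ 2" by (intro mult_right_mono) auto
  finally have R: "R \<le> N ^ 2 / 20" by simp
  have "real (card P ^ 3) \<le> real (card P ^ 2 + card P ^ 2 * K
    + 3 * (card (rich_pairs 80000 P) * card P) + 27 * card {T. ordinary_triangle 80000 P T})"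
    using lineK by (intro of_nat_mono cube_card_le_triangles P)
  then have "N ^ 3 \<le> N ^ 2 + N ^ 2 * real K + 3 * (R * N) + 27 * T"
    by (simp add: N_def R_def T_def)
  moreover have "80000 * N ^ 2 \<le> N ^ 3"
    using mult_right_mono[OF N, of "N ^ 2"] by (simp add: power2_eq_square power3_eq_cube)
  moreover have "10000 * (N ^ 2 * real K) \<le> N ^ 3"
    using mult_left_mono[OF K, of "N ^ 2"] by (simp add: power2_eq_square power3_eq_cube mult_ac)
  moreover have "R * N \<le> N ^ 3 / 20"
    using mult_right_mono[OF R, of N] N by (simp add: power2_eq_square power3_eq_cube)
  moreover have "80000 * N \<le> N ^ 2"
    using mult_right_mono[OF N, of N] N by (simp add: power2_eq_square)
  ultimately have "N \<le> T" using N by linarith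
  then show ?thesis by (simp add: N_def T_def)
qed

theorem theorem1:
  shows "\<exists>(c::nat) (\<delta>::real). \<delta> > 0 \<and>
    (\<forall>P :: (real ^ 2) set.
       finite P \<longrightarrow>
       \<not> (\<exists>L1 L2. is_line L1 \<and> is_line L2 \<and> P \<subseteq> L1 \<union> L2) \<longrightarrow>
       (\<exists>T. ordinary_triangle c P T) \<and>
       real (card {T. ordinary_triangle c P T}) \<ge> \<delta> * real (card P))"
\<comment> \<open>A set of up to 80000 points is only guaranteed one triangle, which makes
  \<open>\<delta>\<close> the reciprocal of \<open>c\<close>.\<close>
proof (rule exI[of _ 80000], rule exI[of _ "1 / 80000"], intro conjI allI impI)
  show "(0::real) < 1 / 80000" by simp
  fix P :: "(real ^ 2) set"
  assume P: "finite P" and two: "\<not> (\<exists>L1 L2. is_line L1 \<and> is_line L2 \<and> P \<subseteq> L1 \<union> L2)"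
  define \<T> where "\<T> = {T. ordinary_triangle 80000 P T}"
  have fin: "finite \<T>" unfolding \<T>_def by (rule finite_ordinary_triangles[OF P])
  have off: "\<not> collinear (P - L)" if "is_line L" for L
  proof
    assume "collinear (P - L)"
    then obtain L' where "is_line L'" "P - L \<subseteq> L'" using collinear_subset_line by blast
    then show False using two that by blast
  qed
  have "\<not> collinear P"
  proof
    assume "collinear P"
    then obtain L where "is_line L" "P \<subseteq> L" using collinear_subset_line by blast
    then show False using two by blast
  qed
  then have "P \<noteq> {}" by auto
  have "card P \<le> 80000 * card \<T>"
  proof (cases "card P \<le> 80000")
    case True
    then have "\<T> \<noteq> {}" using triangle_if_small[OF P \<open>\<not> collinear P\<close>] by (simp add: \<T>_def)
    then have "1 \<le> card \<T>" using fin by (simp add: Suc_le_eq card_gt_0_iff)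
    then show ?thesis using True by linarith
  next
    case False
    show ?thesis
    proof (cases "\<exists>L. is_line L \<and> card P \<le> 10000 * card (P \<inter> L)")
      case True
      then obtain L where L: "is_line L" "card P \<le> 10000 * card (P \<inter> L)" by blast
      \<comment> \<open>As \<open>80000 * card (P \<inter> L)\<close> is at least
        \<open>8 * card P\<close>, taking off \<open>2 * card P\<close> and
        \<open>80000 < card P\<close> still leaves \<open>5 * card P\<close>.\<close>
      show ?thesis
        using triangles_on_rich_line[OF P L(1) off[OF L(1)], of 80000] L(2) False
        unfolding \<T>_def by simp
    next
      case no_rich: False
      then have "card P \<le> card \<T>"
        unfolding \<T>_def using False by (intro many_triangles_if_lines_small[OF P]) (auto simp: not_le)
      then show ?thesis by simp
    qed
  qed
  moreover from this have "\<T> \<noteq> {}" using P \<open>P \<noteq> {}\<close> by auto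
  ultimately show "\<exists>T. ordinary_triangle 80000 P T"
    "1 / 80000 * real (card P) \<le> real (card {T. ordinary_triangle 80000 P T})"
    unfolding \<T>_def by auto
qed

end
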